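(* Let $q\in\mathbb{C}$ with $0<|q|<1$ and $x,y\in\mathbb{C}$. Then for every $n\in\mathbb{N}_0$, \[ \mathfrak{E}_{n,q}(x,y)=\sum_{k=0}^{n}\begin{bmatrix}n\\k\end{bmatrix}_q\frac{2}{[k+1]_q}\left(q^{\frac12k(k+1)}y^{k+1}-\mathfrak{E}_{k+1,q}(0,y)\right)\mathfrak{B}_{n-k,q}(x,0). \]
   Context: $\mathbb{N}_0=\{0,1,2,\dots\}$. For $q\in\mathbb{C}$, $0<|q|<1$: $[n]_q=\frac{1-q^n}{1-q}$, $[0]_q!=1$, $[n]_q!=[1]_q[2]_q\cdots[n]_q$, and $\begin{bmatrix}n\\k\end{bmatrix}_q=\frac{[n]_q!}{[k]_q![n-k]_q!}$ for $0\le k\le n$. Set $e_q(z)=\sum_{n\ge0}\frac{z^n}{[n]_q!}$ and $E_q(z)=\sum_{n\ge0}\frac{q^{n(n-1)/2}z^n}{[n]_q!}$. The $q$-Bernoulli and $q$-Euler polynomials are defined by the power series expansions in $t$ around $0$ \[ \frac{t}{e_q(t)-1}e_q(tx)E_q(ty)=\sum_{n=0}^\infty\mathfrak{B}_{n,q}(x,y)\frac{t^n}{[n]_q!},\qquad \frac{2}{e_q(t)+1}e_q(tx)E_q(ty)=\sum_{n=0}^\infty\mathfrak{E}_{n,q}(x,y)\frac{t^n}{[n]_q!}. \] *)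

theory Defs
  imports "HOL-Complex_Analysis.Complex_Analysis"
begin

definition q_int :: "complex \<Rightarrow> nat \<Rightarrow> complex" where
  "q_int q n = (1 - q ^ n) / (1 - q)"

definition q_fact :: "complex \<Rightarrow> nat \<Rightarrow> complex" where
  "q_fact q n = (\<Prod>k=1..n. q_int q k)"

(* Only meaningful for k \<le> n: the subtraction n - k truncates. *)
definition q_binomial :: "complex \<Rightarrow> nat \<Rightarrow> nat \<Rightarrow> complex" where
  "q_binomial q n k = q_fact q n / (q_fact q k * q_fact q (n - k))"

(* For 0 < |q| < 1 the series of q_exp only converges for |z| < 1 / |1 - q|, and its value is
   unspecified elsewhere; the series of q_Exp converges everywhere. *)
definition q_exp :: "complex \<Rightarrow> complex \<Rightarrow> complex" where
  "q_exp q z = (\<Sum>n. z ^ n / q_fact q n)"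

definition q_Exp :: "complex \<Rightarrow> complex \<Rightarrow> complex" where
  "q_Exp q z = (\<Sum>n. q ^ (n * (n - 1) div 2) * z ^ n / q_fact q n)"

definition q_bernoulli_gf :: "complex \<Rightarrow> complex \<Rightarrow> complex \<Rightarrow> complex \<Rightarrow> complex" where
  "q_bernoulli_gf q x y t = t / (q_exp q t - 1) * q_exp q (t * x) * q_Exp q (t * y)"

definition q_euler_gf :: "complex \<Rightarrow> complex \<Rightarrow> complex \<Rightarrow> complex \<Rightarrow> complex" where
  "q_euler_gf q x y t = 2 / (q_exp q t + 1) * q_exp q (t * x) * q_Exp q (t * y)"

(* t / (e_q(t) - 1) has a removable singularity at t = 0, where division by zero would give
   the value 0 instead of 1; hence remove_sings. *)
definition q_bernoulli :: "complex \<Rightarrow> nat \<Rightarrow> complex \<Rightarrow> complex \<Rightarrow> complex" where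
  "q_bernoulli q n x y =
     q_fact q n * fps_nth (fps_expansion (remove_sings (q_bernoulli_gf q x y)) 0) n"

definition q_euler :: "complex \<Rightarrow> nat \<Rightarrow> complex \<Rightarrow> complex \<Rightarrow> complex" where
  "q_euler q n x y = q_fact q n * fps_nth (fps_expansion (q_euler_gf q x y) 0) n"

end

theory Submission
  imports Defs
begin

text \<open>
  Write \<open>e\<close> and \<open>E\<close> for the two \<open>q\<close>-exponentials. The sequence
  \<open>2 (q^(k(k+1)/2) y^(k+1) - \<EE>(k+1)(0,y)) / [k+1]\<close> has, with weights \<open>t^k/[k]!\<close>, the generating
  function
  \<open>(2/t) (E(ty) - 2 E(ty)/(e(t)+1)) = (2/t) E(ty) (e(t)-1)/(e(t)+1)\<close>:
  the quotient \<open>[k+1]! = [k+1] [k]!\<close> turns the factor \<open>1/[k+1]\<close> into a shift of the index, and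
  the constant term of the bracket vanishes because \<open>e(0) = 1\<close>. Multiplying by the generating
  function \<open>t e(tx)/(e(t)-1)\<close> of the polynomials \<open>\<BB>(n)(x,0)\<close> cancels both \<open>t\<close> and \<open>e(t)-1\<close> and
  leaves \<open>2 e(tx) E(ty)/(e(t)+1)\<close>, which generates \<open>\<EE>(n)(x,y)\<close>. The claim compares the
  coefficients of \<open>t^n\<close>, the \<open>q\<close>-binomials being those of a product of two series with weights
  \<open>1/[n]!\<close>.

  The cancellation is an identity of formal power series (\<open>fps_euler_convolution\<close>), so the
  analytic work consists in reading off the Taylor series of the generating functions
  (\<open>q_euler_eq_fps_nth\<close>, \<open>q_bernoulli_eq_fps_nth\<close>). For this it suffices that both
  \<open>q\<close>-exponential series have a positive radius of convergence.
\<close>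

section \<open>The q-exponentials as power series\<close>

lemma q_int_Suc_nonzero:
  assumes "norm q < 1"
  shows "q_int q (Suc n) \<noteq> 0"
proof -
  have "norm (q ^ Suc n) < 1"
    unfolding norm_power using assms by (subst power_less_one_iff) auto
  hence "q ^ Suc n \<noteq> 1"
    by force
  thus ?thesis
    using assms unfolding q_int_def by auto
qed

lemma q_fact_0 [simp]: "q_fact q 0 = 1"
  by (simp add: q_fact_def)

lemma q_fact_Suc: "q_fact q (Suc n) = q_int q (Suc n) * q_fact q n"
  by (simp add: q_fact_def mult.commute)

lemma q_fact_nonzero:
  assumes "norm q < 1"
  shows "q_fact q n \<noteq> 0"
  using assms by (induction n) (auto simp: q_fact_Suc q_int_Suc_nonzero)

definition fps_q_exp :: "complex \<Rightarrow> complex fps" where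
  "fps_q_exp q = Abs_fps (\<lambda>n. 1 / q_fact q n)"

definition fps_q_Exp :: "complex \<Rightarrow> complex fps" where
  "fps_q_Exp q = Abs_fps (\<lambda>n. q ^ (n * (n - 1) div 2) / q_fact q n)"

lemma fps_nth_q_exp_0 [simp]: "fps_nth (fps_q_exp q) 0 = 1"
  by (simp add: fps_q_exp_def)

lemma fps_nth_q_Exp_0 [simp]: "fps_nth (fps_q_Exp q) 0 = 1"
  by (simp add: fps_q_Exp_def)

text \<open>
  Ratio test: the quotient of consecutive coefficients is \<open>[n+1]\<close>, which tends to
  \<open>1/(1-q)\<close>.
\<close>

lemma fps_conv_radius_q_exp:
  assumes "norm q < 1"
  shows "fps_conv_radius (fps_q_exp q) = ereal (1 / norm (1 - q))"
proof -
  have "(\<lambda>n. q ^ Suc n) \<longlonglongrightarrow> 0"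
    using LIMSEQ_Suc[OF LIMSEQ_power_zero[OF assms]] .
  hence "(\<lambda>n. norm ((1 - q ^ Suc n) / (1 - q))) \<longlonglongrightarrow> norm ((1 - 0) / (1 - q))"
    using assms by (intro tendsto_intros) auto
  also have "(\<lambda>n. norm ((1 - q ^ Suc n) / (1 - q))) =
      (\<lambda>n. norm (1 / q_fact q n) / norm (1 / q_fact q (Suc n)))"
    using q_fact_nonzero[OF assms]
    by (simp add: q_fact_Suc q_int_def norm_mult norm_divide)
  finally show ?thesis
    using assms unfolding fps_conv_radius_def fps_q_exp_def
    by (intro conv_radius_ratio_limit_nonzero) (auto simp: norm_divide)
qed

text \<open>
  The radius is in fact infinite, but only positivity matters, and for that it is enough to
  compare coefficients with those of \<open>fps_q_exp\<close>.
\<close>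

lemma fps_conv_radius_q_Exp_pos:
  assumes "norm q < 1"
  shows "fps_conv_radius (fps_q_Exp q) > 0"
proof -
  have "norm (fps_nth (fps_q_Exp q) n) \<le> norm (fps_nth (fps_q_exp q) n)" for n
    using assms
    by (auto simp: fps_q_exp_def fps_q_Exp_def norm_divide norm_power
             intro!: divide_right_mono power_le_one)
  hence "root n (norm (fps_nth (fps_q_Exp q) n)) \<le> root n (norm (fps_nth (fps_q_exp q) n))" for n
    by (cases "n = 0") auto
  hence "fps_conv_radius (fps_q_exp q) \<le> fps_conv_radius (fps_q_Exp q)"
    unfolding fps_conv_radius_def conv_radius_def
    by (intro ereal_inverse_antimono Limsup_mono always_eventually allI)
       (auto intro!: le_Limsup always_eventually real_root_ge_zero)
  moreover have "0 < fps_conv_radius (fps_q_exp q)"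
    using assms by (auto simp: fps_conv_radius_q_exp)
  ultimately show ?thesis
    by simp
qed

lemma q_exp_has_fps_expansion:
  assumes "norm q < 1"
  shows "q_exp q has_fps_expansion fps_q_exp q"
proof -
  have "q_exp q = eval_fps (fps_q_exp q)"
    by (auto simp: q_exp_def eval_fps_def fps_q_exp_def)
  moreover have "0 < fps_conv_radius (fps_q_exp q)"
    using assms by (auto simp: fps_conv_radius_q_exp)
  ultimately show ?thesis
    by (simp add: eval_fps_has_fps_expansion)
qed

lemma q_Exp_has_fps_expansion:
  assumes "norm q < 1"
  shows "q_Exp q has_fps_expansion fps_q_Exp q"
proof -
  have "q_Exp q = eval_fps (fps_q_Exp q)"
    by (auto simp: q_Exp_def eval_fps_def fps_q_Exp_def)
  thus ?thesis
    using fps_conv_radius_q_Exp_pos[OF assms] by (simp add: eval_fps_has_fps_expansion)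
qed

lemma has_fps_expansion_scale_argument:
  fixes f :: "complex \<Rightarrow> complex"
  assumes "f has_fps_expansion F"
  shows "(\<lambda>t. f (t * c)) has_fps_expansion fps_compose F (fps_const c * fps_X)"
proof -
  have "(f \<circ> (\<lambda>t. c * t)) has_fps_expansion fps_compose F (fps_const c * fps_X)"
    by (intro fps_expansion_intros assms) auto
  thus ?thesis
    by (simp add: o_def mult.commute)
qed

section \<open>Taylor series of the generating functions\<close>

lemma q_euler_eq_fps_nth:
  assumes "norm q < 1"
  shows "q_euler q n x y = q_fact q n * fps_nth
    (2 * inverse (fps_q_exp q + 1) * fps_compose (fps_q_exp q) (fps_const x * fps_X)
       * fps_compose (fps_q_Exp q) (fps_const y * fps_X)) n"
proof -
  have "(\<lambda>t. 2 * inverse (q_exp q t + 1) * q_exp q (t * x) * q_Exp q (t * y)) has_fps_expansion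
    2 * inverse (fps_q_exp q + 1) * fps_compose (fps_q_exp q) (fps_const x * fps_X)
       * fps_compose (fps_q_Exp q) (fps_const y * fps_X)"
    using assms
    by (intro has_fps_expansion_mult has_fps_expansion_inverse has_fps_expansion_add
        has_fps_expansion_scale_argument q_exp_has_fps_expansion q_Exp_has_fps_expansion) auto
  hence "q_euler_gf q x y has_fps_expansion
    2 * inverse (fps_q_exp q + 1) * fps_compose (fps_q_exp q) (fps_const x * fps_X)
       * fps_compose (fps_q_Exp q) (fps_const y * fps_X)"
    by (simp add: q_euler_gf_def[abs_def] divide_inverse)
  thus ?thesis
    by (simp add: q_euler_def fps_expansion_eqI)
qed

text \<open>
  This identifies \<open>remove_sings f\<close> through any analytic function that agrees with \<open>f\<close> on a
  punctured neighbourhood. Such an agreement near \<open>0\<close> persists near every nearby point, and an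
  analytic function has no singularities to remove.
\<close>

lemma remove_sings_has_fps_expansion:
  assumes "g has_fps_expansion G" and "\<forall>\<^sub>F t in at 0. f t = g t"
  shows "remove_sings f has_fps_expansion G"
proof -
  have "\<forall>\<^sub>F t in nhds 0. remove_sings g t = g t"
    using assms(1)
    by (intro eventually_remove_sings_eq_nhds has_fps_expansion_imp_analytic_0)
  moreover have "\<forall>\<^sub>F t in nhds 0. remove_sings f t = remove_sings g t"
  proof -
    obtain S where S: "open S" "0 \<in> S" "\<And>t. t \<in> S \<Longrightarrow> t \<noteq> 0 \<Longrightarrow> f t = g t"
      using assms(2) unfolding eventually_at_topological by auto
    have "remove_sings f w = remove_sings g w" if "w \<in> S" for w
    proof (rule remove_sings_cong)
      show "\<forall>\<^sub>F t in at w. f t = g t"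
      proof (cases "w = 0")
        case False
        hence "\<forall>\<^sub>F t in at w. t \<in> S - {0}"
          using S(1) that by (intro eventually_at_in_open') auto
        thus ?thesis
          by eventually_elim (use S(3) in auto)
      qed (use assms(2) in simp)
    qed simp
    thus ?thesis
      using eventually_nhds_in_open[OF S(1,2)] by (auto elim: eventually_mono)
  qed
  ultimately have "\<forall>\<^sub>F t in nhds 0. g t = remove_sings f t"
    by eventually_elim simp
  thus ?thesis
    using assms(1) has_fps_expansion_cong by blast
qed

text \<open>
  \<open>fps_X\<close> and \<open>fps_q_exp q - 1\<close> both have subdegree \<open>1\<close>, so that their quotient is a formal power
  series; it is the expansion of \<open>t/(e(t)-1)\<close> with the value at \<open>0\<close> filled in.
\<close>

lemma subdegree_q_exp_minus_1:
  assumes "norm q < 1"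
  shows "subdegree (fps_q_exp q - 1) = 1"
proof (rule subdegreeI)
  show "fps_nth (fps_q_exp q - 1) 1 \<noteq> 0"
    using q_fact_nonzero[OF assms, of 1] by (simp add: fps_q_exp_def)
qed simp

lemma q_bernoulli_eq_fps_nth:
  assumes "norm q < 1"
  shows "q_bernoulli q n x 0 = q_fact q n * fps_nth
    (fps_X / (fps_q_exp q - 1) * fps_compose (fps_q_exp q) (fps_const x * fps_X)) n"
proof -
  let ?c = "fps_nth fps_X (subdegree (fps_q_exp q - 1)) /
            fps_nth (fps_q_exp q - 1) (subdegree (fps_q_exp q - 1))"
  let ?B = "fps_X / (fps_q_exp q - 1) * fps_compose (fps_q_exp q) (fps_const x * fps_X)"
  have "fps_q_exp q - 1 \<noteq> 0"
    using subdegree_q_exp_minus_1[OF assms] by force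
  hence "(\<lambda>t. if t = 0 then ?c else t / (q_exp q t - 1)) has_fps_expansion
      fps_X / (fps_q_exp q - 1)"
    by (intro has_fps_expansion_divide has_fps_expansion_fps_X has_fps_expansion_diff
        has_fps_expansion_1 q_exp_has_fps_expansion assms refl)
       (simp_all only: subdegree_q_exp_minus_1[OF assms] subdegree_fps_X order_refl not_False_eq_True)
  hence "(\<lambda>t. (if t = 0 then ?c else t / (q_exp q t - 1)) * q_exp q (t * x)) has_fps_expansion ?B"
    using assms
    by (intro has_fps_expansion_mult has_fps_expansion_scale_argument q_exp_has_fps_expansion)
  moreover have "q_Exp q 0 = 1"
    using has_fps_expansion_imp_0_eq_fps_nth_0[OF q_Exp_has_fps_expansion[OF assms]] by simp
  hence "\<forall>\<^sub>F t in at 0. q_bernoulli_gf q x 0 t =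
      (if t = 0 then ?c else t / (q_exp q t - 1)) * q_exp q (t * x)"
    by (auto simp: q_bernoulli_gf_def eventually_at_filter)
  ultimately have "remove_sings (q_bernoulli_gf q x 0) has_fps_expansion ?B"
    by (rule remove_sings_has_fps_expansion)
  thus ?thesis
    by (simp add: q_bernoulli_def fps_expansion_eqI)
qed

section \<open>The convolution identity\<close>

text \<open>
  This holds because \<open>B - 2 B/(e + 1) = (e - 1) B/(e + 1)\<close>. The constant term of
  \<open>e\<close> makes \<open>e + 1\<close> invertible, and the subdegree makes \<open>fps_X\<close> divisible by \<open>e - 1\<close>. The
  generating functions are the case \<open>A = e(tx)\<close>, \<open>B = E(ty)\<close>.
\<close>

lemma fps_euler_convolution:
  fixes e A B S :: "complex fps"
  assumes "fps_nth e 0 = 1" and "subdegree (e - 1) = 1"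
    and S: "fps_X * S = B - 2 * inverse (e + 1) * B"
  shows "2 * S * (fps_X / (e - 1) * A) = 2 * inverse (e + 1) * A * B"
proof -
  have nz: "e - 1 \<noteq> 0"
    using assms(2) by force
  have quot: "(e - 1) * (fps_X / (e - 1)) = fps_X"
    using assms(2) nz by (simp add: fps_dvd_iff)
  have inv: "inverse (e + 1) * (e + 1) = 1"
    using assms(1) by (intro inverse_mult_eq_1) simp
  have "fps_X * S = B * (inverse (e + 1) * (e + 1) - 2 * inverse (e + 1))"
    unfolding S inv by (simp add: algebra_simps)
  also have "\<dots> = (e - 1) * (inverse (e + 1) * B)"
    by (simp add: algebra_simps)
  finally have S': "fps_X * S = (e - 1) * (inverse (e + 1) * B)" .
  \<comment> \<open>Neither \<open>fps_X\<close> nor \<open>e - 1\<close> is a unit, so both sides are compared after multiplication by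
    \<open>fps_X\<close>.\<close>
  have "fps_X * (2 * S * (fps_X / (e - 1) * A)) = 2 * (fps_X * S) * (fps_X / (e - 1) * A)"
    by (simp add: algebra_simps)
  also have "\<dots> = ((e - 1) * (fps_X / (e - 1))) * (2 * inverse (e + 1) * A * B)"
    unfolding S' by (simp only: mult_ac)
  also have "\<dots> = fps_X * (2 * inverse (e + 1) * A * B)"
    unfolding quot ..
  finally show ?thesis
    by simp
qed

theorem corollary16:
  fixes q x y :: complex and n :: nat
  assumes "0 < norm q" and "norm q < 1"
  shows "q_euler q n x y =
    (\<Sum>k=0..n. q_binomial q n k * (2 / q_int q (k + 1)) *
       (q ^ (k * (k + 1) div 2) * y ^ (k + 1) - q_euler q (k + 1) 0 y) *
       q_bernoulli q (n - k) x 0)"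
proof -
  let ?e = "fps_q_exp q"
  let ?A = "fps_compose ?e (fps_const x * fps_X)"
  let ?B = "fps_compose (fps_q_Exp q) (fps_const y * fps_X)"
  \<comment> \<open>The generating function of \<open>q^(k(k-1)/2) y^k - \<EE>(k)(0,y)\<close> with weights \<open>t^k/[k]!\<close>.\<close>
  define W where "W = ?B - 2 * inverse (?e + 1) * ?B"
  have W_0: "fps_nth W 0 = 0"
    by (simp add: W_def fps_compose_nth_0)
  hence S: "fps_X * fps_shift 1 W = W"
    by (intro fps_ext) (auto simp: fps_X_mult_nth)
  have W_nth: "q ^ (k * (k + 1) div 2) * y ^ (k + 1) - q_euler q (k + 1) 0 y =
      q_fact q (Suc k) * fps_nth W (Suc k)" for k
  proof -
    have "fps_compose ?e (fps_const 0 * fps_X) = 1"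
      by (simp add: fps_eq_iff fps_compose_linear power_0_left)
    hence "q_euler q (k + 1) 0 y =
        q_fact q (Suc k) * fps_nth (2 * inverse (?e + 1) * ?B) (Suc k)"
      using q_euler_eq_fps_nth[OF assms(2), of "Suc k" 0 y] by simp
    moreover have "q ^ (k * (k + 1) div 2) * y ^ (k + 1) = q_fact q (Suc k) * fps_nth ?B (Suc k)"
      unfolding fps_compose_linear using q_fact_nonzero[OF assms(2), of "Suc k"]
      by (simp add: fps_q_Exp_def mult.commute)
    ultimately show ?thesis
      by (simp add: W_def right_diff_distrib)
  qed
  have "q_euler q n x y = q_fact q n * fps_nth (2 * inverse (?e + 1) * ?A * ?B) n"
    by (rule q_euler_eq_fps_nth[OF assms(2)])
  also have "2 * inverse (?e + 1) * ?A * ?B = 2 * fps_shift 1 W * (fps_X / (?e - 1) * ?A)"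
    using S unfolding W_def
    by (intro fps_euler_convolution[symmetric] fps_nth_q_exp_0 subdegree_q_exp_minus_1 assms(2))
  also have "q_fact q n * fps_nth \<dots> n = (\<Sum>k=0..n. q_fact q n *
      (2 * fps_nth W (Suc k) * fps_nth (fps_X / (?e - 1) * ?A) (n - k)))"
    unfolding fps_mult_nth[of "2 * fps_shift 1 W"] sum_distrib_left
    by (simp add: numeral_fps_const)
  also have "\<dots> = (\<Sum>k=0..n. q_binomial q n k * (2 / q_int q (k + 1)) *
       (q ^ (k * (k + 1) div 2) * y ^ (k + 1) - q_euler q (k + 1) 0 y) *
       q_bernoulli q (n - k) x 0)"
    using q_fact_nonzero[OF assms(2)] q_int_Suc_nonzero[OF assms(2)]
    unfolding W_nth q_bernoulli_eq_fps_nth[OF assms(2)]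
    by (intro sum.cong refl) (simp add: q_binomial_def q_fact_Suc)
  finally show ?thesis .
qed

end
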